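(* Let $n\geq 1$ and let $i,j\geq 0$ be integers. Let $W_{n,i,j}$ be the set of triply rooted trees on $[n]$ in which the depth of the second root is $i$ and the depth of the third root is $j$. Then \[ |W_{n,i,j}|=\sum_{d=0}^{\min(i,j)}\frac{(i+j-d+1)\, n!}{(n-i-j+d-1)!}\,n^{\,n-i-j+d-2}, \] with the convention that $1/m!=0$ for negative integers $m$.
   Context: A triply rooted tree on $[n]=\{1,\dots,n\}$ is a labeled tree with vertex set $[n]$ together with three distinguished vertices $r_1,r_2,r_3$ (first, second, third root), not necessarily distinct. The depth of a vertex $v$ is the number of edges on the unique path from the first root $r_1$ to $v$. *)

theory Defs
  imports Complex_Main
begin

text \<open>A labeled graph on [n] = {1..n} is given by its edge set, a set of 2-element subsets.\<close>

definition edge_sets :: "nat \<Rightarrow> nat set set" where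
  "edge_sets n = {{a, b} | a b. a \<in> {1..n} \<and> b \<in> {1..n} \<and> a \<noteq> b}"

definition is_path :: "nat set set \<Rightarrow> nat list \<Rightarrow> nat \<Rightarrow> nat \<Rightarrow> bool" where
  "is_path E p u v \<longleftrightarrow> p \<noteq> [] \<and> hd p = u \<and> last p = v \<and> distinct p \<and>
     (\<forall>k. Suc k < length p \<longrightarrow> {p ! k, p ! Suc k} \<in> E)"

definition is_tree :: "nat \<Rightarrow> nat set set \<Rightarrow> bool" where
  "is_tree n E \<longleftrightarrow> E \<subseteq> edge_sets n \<and>
     (\<forall>u\<in>{1..n}. \<forall>v\<in>{1..n}. \<exists>!p. is_path E p u v)"

definition tree_dist :: "nat set set \<Rightarrow> nat \<Rightarrow> nat \<Rightarrow> nat" where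
  "tree_dist E u v = length (THE p. is_path E p u v) - 1"

definition W :: "nat \<Rightarrow> nat \<Rightarrow> nat \<Rightarrow> (nat set set \<times> nat \<times> nat \<times> nat) set" where
  "W n i j = {(E, r1, r2, r3). is_tree n E \<and> r1 \<in> {1..n} \<and> r2 \<in> {1..n} \<and> r3 \<in> {1..n} \<and>
      tree_dist E r1 r2 = i \<and> tree_dist E r1 r3 = j}"

text \<open>The summand (i+j-d+1) n!/(n-i-j+d-1)! n^(n-i-j+d-2), with 1/m! = 0 for m < 0.\<close>

definition W_term :: "nat \<Rightarrow> nat \<Rightarrow> nat \<Rightarrow> nat \<Rightarrow> real" where
  "W_term n i j d = (let m = int n - int i - int j + int d - 1 in
     if m < 0 then 0
     else real (i + j - d + 1) * fact n / fact (nat m) * real n powi (m - 1))"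

end

theory Submission
  imports Defs "HOL-Library.FuncSet"
begin

text \<open>A tree with first root \<open>r\<close> is the same as the parent function sending every vertex to its neighbour
  towards \<open>r\<close>. The root paths of the second and third root share an initial segment of some length
  \<open>d\<close>, so they span a subtree on \<open>k = i + j - d + 1\<close> vertices, which can be labelled in
  \<open>n! / (n - k)!\<close> ways. Deleting the edges of that subtree turns the trees containing it into
  the forests on \<open>n\<close> vertices with \<open>k\<close> prescribed roots, of which there are \<open>k n\<^sup>n\<^sup>-\<^sup>k\<^sup>-\<^sup>1\<close>.\<close>

subsection \<open>Forests with prescribed roots\<close>

text \<open>The forest count comes from a recursion on the number of non-roots, not from a code for
  trees: with s roots and a non-roots, a set of t children of the roots contributes s^t times a
  smaller forest count, and the resulting sum is a differentiated binomial expansion. The exponent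
  n-k-1 is -1 when every vertex is a root, so counts are carried multiplied by the number of
  vertices, and division by n happens only at the very end. A tree is given only as an edge set with
  unique paths; comparing distances to the root is what ties this to parent functions. The sum over
  \<open>d\<close> counts nothing twice because \<open>d\<close> is recoverable: it is the greatest
  depth at which the two root paths agree.\<close>

inductive reaches :: "('a \<Rightarrow> 'a) \<Rightarrow> 'a set \<Rightarrow> 'a \<Rightarrow> bool" for f S where
  base: "s \<in> S \<Longrightarrow> reaches f S s"
| step: "reaches f S (f v) \<Longrightarrow> reaches f S v"

lemma reaches_step_eq: "f v = w \<Longrightarrow> reaches f S w \<Longrightarrow> reaches f S v"
  by (simp add: reaches.step)

text \<open>Roots are fixed points, so a parent is defined everywhere on \<open>V\<close>.
  Extensionality off \<open>V\<close> keeps the set finite and makes a forest determined by its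
  values on \<open>V\<close>.\<close>

definition forests :: "'a set \<Rightarrow> 'a set \<Rightarrow> ('a \<Rightarrow> 'a) set" where
  "forests V S = {f \<in> V \<rightarrow>\<^sub>E V. (\<forall>s\<in>S. f s = s) \<and> (\<forall>v\<in>V. reaches f S v)}"

lemma forestsI:
  assumes "f \<in> V \<rightarrow>\<^sub>E V" "\<And>s. s \<in> S \<Longrightarrow> f s = s" "\<And>v. v \<in> V \<Longrightarrow> reaches f S v"
  shows "f \<in> forests V S"
  using assms unfolding forests_def by auto

lemma forestsD:
  assumes "f \<in> forests V S"
  shows "f \<in> V \<rightarrow>\<^sub>E V" "s \<in> S \<Longrightarrow> f s = s" "v \<in> V \<Longrightarrow> reaches f S v"
    "v \<in> V \<Longrightarrow> f v \<in> V"
  using assms unfolding forests_def by auto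

lemma finite_forests: "finite V \<Longrightarrow> finite (forests V S)"
  unfolding forests_def by (rule finite_subset[of _ "V \<rightarrow>\<^sub>E V"]) (auto intro: finite_PiE)

lemma forests_empty: "V \<noteq> {} \<Longrightarrow> forests V {} = {}"
proof -
  assume "V \<noteq> {}"
  moreover have "\<not> reaches f {} v" for f and v :: 'a
    by (rule notI, erule reaches.induct) auto
  ultimately show ?thesis unfolding forests_def by auto
qed

text \<open>The second sum is x d/dx applied to the first. The factor \<open>x + y\<close> replaces
  the exponent \<open>card A - 1\<close>, which would fail for empty \<open>A\<close>. Both follow
  by splitting subsets according to whether they contain the new element.\<close>

lemma sum_Pow_weighted:
  fixes x y :: nat
  assumes "finite A"
  shows "(\<Sum>T\<in>Pow A. x ^ card T * y ^ (card A - card T)) = (x + y) ^ card A"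
    and "(x + y) * (\<Sum>T\<in>Pow A. card T * x ^ card T * y ^ (card A - card T)) =
      card A * x * (x + y) ^ card A"
  using assms
proof (induction A)
  case (insert a A)
  have split: "(\<Sum>T\<in>Pow (insert a A). g T) = (\<Sum>T\<in>Pow A. g T) + (\<Sum>T\<in>Pow A. g (insert a T))"
    for g :: "'a set \<Rightarrow> nat"
  proof -
    have "inj_on (insert a) (Pow A)"
      using insert.hyps by (auto simp: inj_on_def)
    moreover have "Pow A \<inter> insert a ` Pow A = {}" using insert.hyps by auto
    ultimately show ?thesis
      using insert.hyps by (simp add: Pow_insert sum.union_disjoint sum.reindex)
  qed
  have c: "card (insert a T) = Suc (card T)" "card T \<le> card A" if "T \<in> Pow A" for T
    using that insert.hyps by (auto simp: card_insert_if finite_subset card_mono)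
  have p: "y ^ (Suc (card A) - card T) = y * y ^ (card A - card T)" if "T \<in> Pow A" for T
    using c[OF that] by (simp add: Suc_diff_le)
  define G where "G = (\<Sum>T\<in>Pow A. x ^ card T * y ^ (card A - card T))"
  define H where "H = (\<Sum>T\<in>Pow A. card T * x ^ card T * y ^ (card A - card T))"
  have card: "card (insert a A) = Suc (card A)" using insert.hyps by simp
  note IH = insert.IH[folded G_def H_def]
  {
    case 1
    have "(\<Sum>T\<in>Pow (insert a A). x ^ card T * y ^ (card (insert a A) - card T)) = y * G + x * G"
      unfolding split card G_def sum_distrib_left
      by (intro arg_cong2[where f = "(+)"] sum.cong refl) (simp_all add: c p)
    then show ?case unfolding card using IH(1) by (simp add: algebra_simps)
  next
    case 2
    have "(\<Sum>T\<in>Pow (insert a A). card T * x ^ card T * y ^ (card (insert a A) - card T)) =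
      y * H + (x * H + x * G)"
      unfolding split card G_def H_def sum_distrib_left sum.distrib[symmetric]
      by (intro arg_cong2[where f = "(+)"] sum.cong refl) (simp_all add: c p algebra_simps)
    then have "(x + y) * (\<Sum>T\<in>Pow (insert a A). card T * x ^ card T * y ^ (card (insert a A) - card T)) =
      (x + y) * ((x + y) * H) + (x + y) * x * G"
      by (simp add: algebra_simps)
    also have "\<dots> = card (insert a A) * x * (x + y) ^ card (insert a A)"
      unfolding IH card by (simp add: algebra_simps)
    finally show ?case .
  }
qed auto

text \<open>A forest is determined by the set \<open>T\<close> of children of the roots, the edges from \<open>T\<close> to the
  roots, and the forest with root set \<open>T\<close> that remains when the roots are deleted.\<close>

lemma card_forests_with_children:
  assumes "finite V" "S \<subseteq> V" "T \<subseteq> V - S"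
  shows "card {f \<in> forests V S. {v \<in> V - S. f v \<in> S} = T} = card S ^ card T * card (forests (V - S) T)"
proof -
  let ?A = "{f \<in> forests V S. {v \<in> V - S. f v \<in> S} = T}"
  let ?B = "(T \<rightarrow>\<^sub>E S) \<times> forests (V - S) T"
  let ?F = "\<lambda>f. (restrict f T, \<lambda>v\<in>V - S. if v \<in> T then v else f v)"
  let ?G = "\<lambda>(t, g). \<lambda>v\<in>V. if v \<in> S then v else if v \<in> T then t v else g v"
  have "bij_betw ?F ?A ?B"
  proof (rule bij_betwI[where g = ?G])
    show "?F \<in> ?A \<rightarrow> ?B"
    proof
      fix f assume f: "f \<in> ?A"
      then have fF: "f \<in> forests V S" and T: "\<And>v. v \<in> V \<Longrightarrow> v \<notin> S \<Longrightarrow> f v \<in> S \<longleftrightarrow> v \<in> T" by auto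
      let ?g = "\<lambda>v\<in>V - S. if v \<in> T then v else f v"
      \<comment> \<open>The premise makes the base case vacuous: a walk from a non-root enters
        \<open>S\<close> only through a vertex of \<open>T\<close>, where the walk of the new forest
        stops.\<close>
      have "v \<in> V - S \<longrightarrow> reaches ?g T v" if "reaches f S v" for v
        using that
      proof induction
        case (step v)
        show ?case
        proof
          assume v: "v \<in> V - S"
          show "reaches ?g T v"
          proof (cases "v \<in> T")
            case False
            then have "f v \<in> V - S" using v T forestsD(4)[OF fF] by auto
            then have "reaches ?g T (f v)" using step.IH by blast
            moreover have "?g v = f v" using v False by simp
            ultimately show ?thesis by (rule reaches_step_eq[rotated])
          qed (rule reaches.base)
        qed
      qed auto
      then have "?g \<in> forests (V - S) T"
        using forestsD[OF fF] T assms by (intro forestsI) auto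
      moreover have "restrict f T \<in> T \<rightarrow>\<^sub>E S" using f by auto
      ultimately show "?F f \<in> ?B" by simp
    qed
    show "?G \<in> ?B \<rightarrow> ?A"
    proof
      fix x assume "x \<in> ?B"
      then obtain t g where x: "x = (t, g)" and t: "t \<in> T \<rightarrow>\<^sub>E S" and g: "g \<in> forests (V - S) T"
        by auto
      note gD = forestsD[OF g]
      have r: "v \<in> V - S \<longrightarrow> reaches (?G (t, g)) S v" if "reaches g T v" for v
        using that
      proof induction
        case (base v)
        then have "?G (t, g) v \<in> S" if "v \<in> V - S" using t that by auto
        then show ?case by (blast intro: reaches.intros)
      next
        case (step v)
        show ?case
        proof
          assume v: "v \<in> V - S"
          show "reaches (?G (t, g)) S v"
          proof (cases "v \<in> T")
            case True
            then have "?G (t, g) v \<in> S" using t v by auto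
            then show ?thesis by (blast intro: reaches.intros)
          next
            case False
            have "reaches (?G (t, g)) S (g v)" using step.IH gD(4) v by blast
            moreover have "?G (t, g) v = g v" using v False by simp
            ultimately show ?thesis by (rule reaches_step_eq[rotated])
          qed
        qed
      qed
      have "?G (t, g) \<in> forests V S"
      proof (rule forestsI)
        have "t v \<in> V" if "v \<in> T" for v using PiE_mem[OF t that] assms(2) by blast
        then show "?G (t, g) \<in> V \<rightarrow>\<^sub>E V"
          using gD(4) by auto
        show "?G (t, g) s = s" if "s \<in> S" for s using that assms by auto
        show "reaches (?G (t, g)) S v" if "v \<in> V" for v
          using r[OF gD(3)] that by (cases "v \<in> S") (auto intro: reaches.base)
      qed
      moreover have "{v \<in> V - S. ?G (t, g) v \<in> S} = T"
        using PiE_mem[OF t] gD(4) assms by (auto split: if_splits)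
      ultimately show "?G x \<in> ?A" unfolding x by simp
    qed
    show "?G (?F f) = f" if "f \<in> ?A" for f
    proof
      fix v
      show "?G (?F f) v = f v"
        using that forestsD(1,2)[of f V S] assms by (auto simp: PiE_def extensional_def)
    qed
    show "?F (?G x) = x" if "x \<in> ?B" for x
    proof -
      obtain t g where x: "x = (t, g)" and t: "t \<in> T \<rightarrow>\<^sub>E S" and g: "g \<in> forests (V - S) T"
        using \<open>x \<in> ?B\<close> by auto
      have "restrict (?G (t, g)) T = t"
        using t assms by (intro ext) (auto simp: PiE_def extensional_def)
      moreover have "(\<lambda>v\<in>V - S. if v \<in> T then v else ?G (t, g) v) = g"
        using forestsD(1,2)[OF g] assms by (intro ext) (auto simp: PiE_def extensional_def)
      ultimately show ?thesis unfolding x by simp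
    qed
  qed
  then have "card ?A = card ?B" by (rule bij_betw_same_card)
  also have "\<dots> = card S ^ card T * card (forests (V - S) T)"
    using finite_subset[OF assms(3)] assms(1) by (simp add: card_cartesian_product card_PiE)
  finally show ?thesis .
qed

text \<open>This generalizes Cayley's formula. Conditioning on the children \<open>T\<close> of the
  roots replaces \<open>V\<close>, \<open>S\<close> by \<open>V - S\<close>, \<open>T\<close>, which
  has fewer non-roots as soon as \<open>T\<close> is nonempty.\<close>

lemma card_forests:
  assumes "finite V" "S \<subseteq> V"
  shows "card V * card (forests V S) = card S * card V ^ (card V - card S)"
  using assms
proof (induction "card V - card S" arbitrary: V S rule: less_induct)
  case less
  have finS: "finite S" using less.prems finite_subset by auto
  consider "V = S" | "S = {}" "V \<noteq> {}" | "S \<noteq> {}" "V \<noteq> S" by auto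
  then show ?case
  proof cases
    case 1
    have "forests V S = {\<lambda>v\<in>V. v}"
      unfolding 1 forests_def
      by (auto simp: PiE_def extensional_def fun_eq_iff intro: reaches.base)
    then show ?thesis using 1 by simp
  next
    case 2
    then show ?thesis by (simp add: forests_empty)
  next
    case 3
    let ?A = "V - S" and ?s = "card S"
    let ?a = "card ?A"
    have finA: "finite ?A" using less.prems by simp
    have cA: "?a = card V - ?s" using less.prems finS by (simp add: card_Diff_subset)
    have a0: "?a > 0" using 3 less.prems by (auto simp: card_gt_0_iff)
    have le: "?s \<le> card V" using less.prems by (simp add: card_mono)
    have "(\<lambda>f. {v \<in> V - S. f v \<in> S}) ` forests V S \<subseteq> Pow ?A" by blast
    then have "card (forests V S) = (\<Sum>T\<in>Pow ?A. card {f \<in> forests V S. {v \<in> V - S. f v \<in> S} = T})"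
      using sum.group[OF finite_forests[OF less.prems(1), of S], of "Pow ?A" _ "\<lambda>_. 1 :: nat"] finA
      by simp
    also have "\<dots> = (\<Sum>T\<in>Pow ?A. ?s ^ card T * card (forests ?A T))"
      using less.prems by (intro sum.cong refl card_forests_with_children) auto
    finally have "?a * card (forests V S) = (\<Sum>T\<in>Pow ?A. ?s ^ card T * (?a * card (forests ?A T)))"
      by (simp add: sum_distrib_left mult.left_commute)
    also have "\<dots> = (\<Sum>T\<in>Pow ?A. ?s ^ card T * (card T * ?a ^ (?a - card T)))"
    proof (intro sum.cong refl)
      fix T assume T: "T \<in> Pow ?A"
      \<comment> \<open>An empty \<open>T\<close> does not decrease the induction measure, but then
        both sides vanish, since a nonempty vertex set has no forest without roots.\<close>
      have "?a * card (forests ?A T) = card T * ?a ^ (?a - card T)"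
      proof (cases "T = {}")
        case True
        then show ?thesis using 3 less.prems by (subst True, subst forests_empty) auto
      next
        case False
        then have "card T > 0" using T finA finite_subset by (auto simp: card_gt_0_iff)
        then have "?a - card T < card V - ?s" using cA a0 by simp
        then show ?thesis using less.hyps[of ?A T] T finA by auto
      qed
      then show "?s ^ card T * (?a * card (forests ?A T)) = ?s ^ card T * (card T * ?a ^ (?a - card T))"
        by simp
    qed
    finally have "?a * card (forests V S) = (\<Sum>T\<in>Pow ?A. card T * ?s ^ card T * ?a ^ (?a - card T))"
      by (simp add: mult_ac)
    \<comment> \<open>Here \<open>card V\<close> is the sum of the two weights \<open>?s\<close> and
      \<open>?a\<close>, exactly the factor that closes the weighted binomial sum.\<close>
    then have "?a * (card V * card (forests V S)) =
      (?s + ?a) * (\<Sum>T\<in>Pow ?A. card T * ?s ^ card T * ?a ^ (?a - card T))"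
      using cA le by simp
    also have "\<dots> = ?a * (?s * (?s + ?a) ^ ?a)"
      by (subst sum_Pow_weighted(2)[OF finA]) simp
    finally show ?thesis using a0 cA le by simp
  qed
qed

text \<open>On \<open>S\<close> the values are frozen, so they may be switched between
  \<open>p\<close> and the identity. Reaching \<open>r\<close> and reaching \<open>S\<close> then
  correspond, because \<open>p\<close> alone leads every vertex of \<open>S\<close> to
  \<open>r\<close>.\<close>

lemma card_forests_extending:
  assumes "S \<subseteq> V" "r \<in> S" "p \<in> forests S {r}"
  shows "card {f \<in> forests V {r}. \<forall>s\<in>S. f s = p s} = card (forests V S)"
proof (rule bij_betw_same_card)
  let ?A = "{f \<in> forests V {r}. \<forall>s\<in>S. f s = p s}"
  let ?F = "\<lambda>f. \<lambda>v\<in>V. if v \<in> S then v else f v"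
  let ?G = "\<lambda>g. \<lambda>v\<in>V. if v \<in> S then p v else g v"
  note pD = forestsD[OF assms(3)]
  show "bij_betw ?F ?A (forests V S)"
  proof (rule bij_betwI[where g = ?G])
    show "?F \<in> ?A \<rightarrow> forests V S"
    proof
      fix f assume "f \<in> ?A"
      then have fF: "f \<in> forests V {r}" by auto
      have r: "v \<in> V \<longrightarrow> reaches (?F f) S v" if "reaches f {r} v" for v
        using that
      proof induction
        case (step v)
        show ?case
        proof
          assume v: "v \<in> V"
          show "reaches (?F f) S v"
          proof (cases "v \<in> S")
            case False
            have "reaches (?F f) S (f v)" using step.IH forestsD(4)[OF fF v] by blast
            moreover have "?F f v = f v" using v False by simp
            ultimately show ?thesis by (rule reaches_step_eq[rotated])
          qed (rule reaches.base)
        qed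
      qed (use assms in \<open>auto intro: reaches.base\<close>)
      show "?F f \<in> forests V S"
        using forestsD[OF fF] r assms by (intro forestsI) auto
    qed
    show "?G \<in> forests V S \<rightarrow> ?A"
    proof
      fix g assume g: "g \<in> forests V S"
      have p: "v \<in> S \<longrightarrow> reaches (?G g) {r} v" if "reaches p {r} v" for v
        using that
      proof induction
        case (step v)
        show ?case
        proof
          assume v: "v \<in> S"
          then have "?G g v = p v" using assms(1) by auto
          moreover have "reaches (?G g) {r} (p v)" using step.IH pD(4)[OF v] by blast
          ultimately show "reaches (?G g) {r} v" by (rule reaches_step_eq)
        qed
      qed (auto intro: reaches.base)
      have r: "v \<in> V \<longrightarrow> reaches (?G g) {r} v" if "reaches g S v" for v
        using that
      proof induction
        case (base v)
        then show ?case using p pD(3) by blast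
      next
        case (step v)
        show ?case
        proof
          assume v: "v \<in> V"
          show "reaches (?G g) {r} v"
          proof (cases "v \<in> S")
            case True
            then show ?thesis using p pD(3) by blast
          next
            case False
            have "reaches (?G g) {r} (g v)" using step.IH forestsD(4)[OF g v] by blast
            moreover have "?G g v = g v" using v False by simp
            ultimately show ?thesis by (rule reaches_step_eq[rotated])
          qed
        qed
      qed
      have "?G g \<in> forests V {r}"
        using forestsD[OF g] r assms pD(2) subsetD[OF assms(1) pD(4)] by (intro forestsI) auto
      then show "?G g \<in> ?A" using assms(1) by auto
    qed
    show "?G (?F f) = f" if "f \<in> ?A" for f
      using that forestsD(1)[of f V "{r}"] assms(1)
      by (intro ext) (auto simp: PiE_def extensional_def)
    show "?F (?G g) = g" if "g \<in> forests V S" for g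
      using forestsD(1,2)[OF that] by (intro ext) (auto simp: PiE_def extensional_def)
  qed
qed

subsection \<open>Trees and parent functions\<close>

definition height :: "('a \<Rightarrow> 'a) \<Rightarrow> 'a \<Rightarrow> 'a \<Rightarrow> nat" where
  "height f r v = (LEAST k. (f ^^ k) v = r)"

lemma height_root [simp]: "height f r r = 0"
  unfolding height_def by (rule Least_eq_0) simp

lemma reaches_funpow: "reaches f {r} v \<Longrightarrow> \<exists>k. (f ^^ k) v = r"
proof (induction rule: reaches.induct)
  case (base s)
  then show ?case by (intro exI[of _ 0]) simp
next
  case (step v)
  then obtain k where "(f ^^ k) (f v) = r" by blast
  then show ?case by (intro exI[of _ "Suc k"]) (simp add: funpow_swap1)
qed

context
  fixes f :: "'a \<Rightarrow> 'a" and V r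
  assumes f: "f \<in> forests V {r}"
begin

lemma funpow_height: "v \<in> V \<Longrightarrow> (f ^^ height f r v) v = r"
  unfolding height_def using reaches_funpow[OF forestsD(3)[OF f]] by (rule LeastI_ex)

lemma height_step:
  assumes "v \<in> V" "v \<noteq> r"
  shows "height f r v = Suc (height f r (f v))"
proof -
  obtain k where "(f ^^ k) v = r" using funpow_height assms by blast
  then show ?thesis
    unfolding height_def using assms
    by (subst Least_Suc[of _ k]) (auto simp: funpow_swap1)
qed

lemma height_eq_0_iff: "v \<in> V \<Longrightarrow> height f r v = 0 \<longleftrightarrow> v = r"
  using height_step by force

lemma funpow_in: "v \<in> V \<Longrightarrow> (f ^^ k) v \<in> V"
  using forestsD(4)[OF f] by (induction k) auto

text \<open>Truncated subtraction is correct because the root is a fixed point: surplus steps stay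
  at height 0.\<close>

lemma height_funpow:
  "v \<in> V \<Longrightarrow> height f r ((f ^^ k) v) = height f r v - k"
proof (induction k)
  case (Suc k)
  then show ?case
    using height_step[of "(f ^^ k) v"] funpow_in[of v k] forestsD(2)[OF f, of r]
    by (cases "(f ^^ k) v = r") auto
qed simp

end

section \<open>Paths in an edge set\<close>

lemma is_path_singleton [simp]: "is_path E [x] u v \<longleftrightarrow> x = u \<and> x = v"
  unfolding is_path_def by auto

lemma is_path_Cons2 [simp]:
  "is_path E (x # y # p) u v \<longleftrightarrow>
    x = u \<and> {x, y} \<in> E \<and> x \<notin> set (y # p) \<and> is_path E (y # p) y v"
  unfolding is_path_def by (auto simp: nth_Cons split: nat.splits)

lemma is_path_Nil [simp]: "\<not> is_path E [] u v"
  unfolding is_path_def by simp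

lemma is_path_Cons_iff:
  "is_path E (x # p) u v \<longleftrightarrow>
    x = u \<and> (p = [] \<and> u = v \<or> {x, hd p} \<in> E \<and> x \<notin> set p \<and> is_path E p (hd p) v)"
  by (cases p) auto

lemma is_path_hd: "is_path E p u v \<Longrightarrow> hd p = u"
  unfolding is_path_def by simp

lemma is_path_same: "is_path E p u u \<Longrightarrow> p = [u]"
  unfolding is_path_def
  by (cases p) (auto split: if_splits dest: last_in_set)

lemma is_path_rev:
  assumes "is_path E p u v"
  shows "is_path E (rev p) v u"
proof -
  have "{rev p ! k, rev p ! Suc k} \<in> E" if k: "Suc k < length p" for k
  proof -
    let ?m = "length p - Suc (Suc k)"
    have "Suc ?m < length p" "length p - Suc k = Suc ?m" using k by auto
    then have "{p ! ?m, p ! Suc ?m} \<in> E" using assms unfolding is_path_def by blast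
    then show ?thesis using k \<open>length p - Suc k = Suc ?m\<close> by (simp add: rev_nth insert_commute)
  qed
  then show ?thesis using assms unfolding is_path_def by (simp add: hd_rev last_rev)
qed

lemma is_path_suffix:
  "is_path E (xs @ y # ys) u v \<Longrightarrow> is_path E (y # ys) y v"
proof (induction xs arbitrary: u)
  case (Cons x xs)
  then show ?case by (cases xs) auto
qed (auto simp: is_path_Cons_iff)

text \<open>Paths must be distinct, so if \<open>u\<close> already lies on \<open>p\<close> the path
  is cut back to \<open>u\<close> instead of being lengthened.\<close>

lemma is_path_extend:
  assumes "is_path E p v w" "{u, v} \<in> E"
  shows "\<exists>q. is_path E q u w"
proof (cases "u \<in> set p")
  case True
  then show ?thesis using assms(1) is_path_suffix by (metis split_list)
next
  case False
  then have "is_path E (u # p) u w"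
    using assms is_path_hd[OF assms(1)] by (auto simp: is_path_Cons_iff)
  then show ?thesis ..
qed

text \<open>The root is left out because it is its own parent and would yield a singleton instead of
  an edge.\<close>

definition forest_edges :: "'a set \<Rightarrow> ('a \<Rightarrow> 'a) \<Rightarrow> 'a \<Rightarrow> 'a set set" where
  "forest_edges V f r = (\<lambda>v. {v, f v}) ` (V - {r})"

lemma forest_edge_cases:
  assumes "{u, v} \<in> forest_edges V f r"
  obtains "u \<in> V" "u \<noteq> r" "v = f u" | "v \<in> V" "v \<noteq> r" "u = f v"
proof -
  obtain w where "w \<in> V" "w \<noteq> r" "{u, v} = {w, f w}"
    using assms unfolding forest_edges_def by blast
  then show thesis using that by (auto simp: doubleton_eq_iff)
qed

section \<open>Unique paths in the edge set of a parent function\<close>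

context
  fixes f :: "nat \<Rightarrow> nat" and V r
  assumes f: "f \<in> forests V {r}" and r: "r \<in> V"
begin

text \<open>A path that has once moved away from the root can never turn back.\<close>

lemma height_less_of_descending_path:
  assumes "is_path (forest_edges V f r) (u # w # p) u v" "w \<in> V" "w \<noteq> r" "f w = u"
  shows "height f r u < height f r v"
  using assms
proof (induction p arbitrary: u w)
  case Nil
  then show ?case using height_step[OF f, of w] by auto
next
  case (Cons x p)
  \<comment> \<open>Distinctness rules out a return to \<open>u = f w\<close>, so the next edge
    again leads to a child.\<close>
  then have "{w, x} \<in> forest_edges V f r" "x \<noteq> f w" by auto
  then have "x \<in> V" "x \<noteq> r" "f x = w" by (auto elim: forest_edge_cases)
  then have "height f r w < height f r v" using Cons by auto
  then show ?case using height_step[OF f, of w] Cons.prems by auto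
qed

text \<open>A first move to a child would make the endpoint \<open>v\<close> strictly higher than
  \<open>u\<close>; hence the first move goes to the parent.\<close>

lemma path_step:
  assumes "is_path (forest_edges V f r) p u v" "u \<noteq> v" "height f r v \<le> height f r u"
  obtains q where "p = u # q" "is_path (forest_edges V f r) q (f u) v"
proof -
  obtain w q where p: "p = u # w # q"
    using assms by (cases p rule: remdups_adj.cases) auto
  then have "{u, w} \<in> forest_edges V f r" using assms by auto
  then have "w = f u"
    using height_less_of_descending_path[of u w q v] assms p
    by (auto elim!: forest_edge_cases)
  then show thesis using that p assms by auto
qed

text \<open>The first step from the higher endpoint is forced to its parent, which lowers the sum of
  the heights. If the higher endpoint is the last one, the path is reversed.\<close>

lemma forest_ex1_path:
  assumes "u \<in> V" "v \<in> V"
  shows "\<exists>!p. is_path (forest_edges V f r) p u v"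
  using assms
proof (induction "height f r u + height f r v" arbitrary: u v rule: less_induct)
  case less
  let ?E = "forest_edges V f r"
  have *: "\<exists>!p. is_path ?E p a b"
    if ab: "{a, b} = {u, v}" and ne: "a \<noteq> b" and le: "height f r b \<le> height f r a" for a b
  proof -
    have V: "a \<in> V" "b \<in> V" using ab less.prems by (auto simp: doubleton_eq_iff)
    have "a \<noteq> r" using le ne height_eq_0_iff[OF f V(2)] by auto
    then have h: "height f r a = Suc (height f r (f a))" using height_step[OF f V(1)] by simp
    have "height f r a + height f r b = height f r u + height f r v"
      using ab by (auto simp: doubleton_eq_iff)
    then have "\<exists>!q. is_path ?E q (f a) b"
      using less.hyps[of "f a" b] h V forestsD(4)[OF f] by auto
    then obtain q where q: "is_path ?E q (f a) b" and uq: "\<And>q'. is_path ?E q' (f a) b \<Longrightarrow> q' = q"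
      by blast
    have "{a, f a} \<in> ?E" using V \<open>a \<noteq> r\<close> unfolding forest_edges_def by blast
    then obtain p where p: "is_path ?E p a b" using is_path_extend[OF q] by blast
    have "p' = a # q" if "is_path ?E p' a b" for p'
      using path_step[OF that ne le] uq by metis
    then show ?thesis using p by metis
  qed
  consider "u = v" | "u \<noteq> v" "height f r v \<le> height f r u" | "u \<noteq> v" "height f r u \<le> height f r v"
    by linarith
  then show ?case
  proof cases
    case 1
    then show ?thesis using is_path_same by (intro ex1I[of _ "[u]"]) auto
  next
    case 2
    then show ?thesis using * by blast
  next
    case 3
    then have "\<exists>!p. is_path ?E p v u" using * by blast
    then show ?thesis using is_path_rev by (metis rev_rev_ident)
  qed
qed

text \<open>The iterates are distinct because their heights decrease by one at each step down to
  0.\<close>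

lemma forest_path_to_root:
  assumes "v \<in> V"
  shows "is_path (forest_edges V f r) (map (\<lambda>k. (f ^^ k) v) [0..<Suc (height f r v)]) v r"
proof -
  let ?h = "height f r v"
  let ?p = "map (\<lambda>k. (f ^^ k) v) [0..<Suc ?h]"
  have h: "height f r ((f ^^ k) v) = ?h - k" for k
    using height_funpow[OF f assms] .
  have "inj_on (\<lambda>k. (f ^^ k) v) {0..<Suc ?h}"
  proof (rule inj_onI)
    fix k l assume kl: "k \<in> {0..<Suc ?h}" "l \<in> {0..<Suc ?h}" and "(f ^^ k) v = (f ^^ l) v"
    then have "?h - k = ?h - l" using h by metis
    then show "k = l" using kl by auto
  qed
  moreover have "{(f ^^ k) v, (f ^^ Suc k) v} \<in> forest_edges V f r" if "k < ?h" for k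
  proof -
    have "(f ^^ k) v \<in> V" "(f ^^ k) v \<noteq> r"
      using funpow_in[OF f assms] h[of k] that by auto
    then show ?thesis unfolding forest_edges_def by auto
  qed
  ultimately show ?thesis
    unfolding is_path_def using funpow_height[OF f assms]
    by (auto simp: distinct_map hd_map hd_upt last_map nth_append simp del: upt_Suc)
qed

lemma tree_dist_forest:
  assumes "v \<in> V"
  shows "tree_dist (forest_edges V f r) r v = height f r v"
proof -
  have "(THE p. is_path (forest_edges V f r) p r v) =
    rev (map (\<lambda>k. (f ^^ k) v) [0..<Suc (height f r v)])"
    using forest_ex1_path[OF r assms] is_path_rev[OF forest_path_to_root[OF assms]]
    by (rule the1_equality)
  then show ?thesis unfolding tree_dist_def by simp
qed

end

text \<open>The parent of a non-root is the second vertex of its unique path to \<open>r\<close>,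
  and that path depends only on the edge set.\<close>

lemma forest_edges_inj:
  fixes f g :: "nat \<Rightarrow> nat"
  assumes "f \<in> forests V {r}" "g \<in> forests V {r}" "r \<in> V"
    and E: "forest_edges V f r = forest_edges V g r"
  shows "f = g"
proof
  fix v
  show "f v = g v"
  proof (cases "v \<in> V - {r}")
    case True
    let ?p = "\<lambda>f. map (\<lambda>k. (f ^^ k) v) [0..<Suc (height f r v)]"
    have "?p f = ?p g"
      using forest_ex1_path[OF assms(1,3), of v r] forest_path_to_root[OF assms(1,3), of v]
        forest_path_to_root[OF assms(2,3), of v] True E assms(3) by auto
    moreover have "height f r v \<noteq> 0" "height g r v \<noteq> 0"
      using True height_eq_0_iff[OF assms(1)] height_eq_0_iff[OF assms(2)] by auto
    ultimately have "?p f ! 1 = ?p g ! 1" "1 < Suc (height f r v)" "1 < Suc (height g r v)" by auto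
    then show ?thesis by (simp del: upt_Suc)
  next
    case False
    then show ?thesis
      using forestsD(1,2)[OF assms(1)] forestsD(1,2)[OF assms(2)]
      by (cases "v = r") (auto simp: PiE_def extensional_def)
  qed
qed

section \<open>Rooted trees correspond to parent functions\<close>

lemma is_tree_forest_edges:
  assumes "f \<in> forests {1..n} {r}" "r \<in> {1..n}"
  shows "is_tree n (forest_edges {1..n} f r)"
proof -
  have "f v \<noteq> v" if "v \<in> {1..n}" "v \<noteq> r" for v
    using height_step[OF assms(1) that] by auto
  then have "forest_edges {1..n} f r \<subseteq> edge_sets n"
    using forestsD(4)[OF assms(1)] unfolding forest_edges_def edge_sets_def by fastforce
  then show ?thesis
    unfolding is_tree_def using forest_ex1_path[OF assms] by auto
qed

lemma tree_is_forest_edges: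
  assumes "is_tree n E" "r \<in> {1..n}"
  obtains f where "f \<in> forests {1..n} {r}" "E = forest_edges {1..n} f r"
proof -
  let ?V = "{1..n}"
  have edge: "a \<in> ?V" "b \<in> ?V" "a \<noteq> b" if "{a, b} \<in> E" for a b
    using that assms(1) unfolding is_tree_def edge_sets_def by (auto simp: doubleton_eq_iff)
  define P where "P v = (THE p. is_path E p v r)" for v
  have ex1: "\<exists>!p. is_path E p v r" if "v \<in> ?V" for v
    using assms that unfolding is_tree_def by blast
  have P: "is_path E (P v) v r" if "v \<in> ?V" for v
    unfolding P_def using ex1[OF that] by (rule theI')
  have P_eq: "P v = p" if "v \<in> ?V" "is_path E p v r" for v p
    using ex1[OF that(1)] P[OF that(1)] that(2) by blast
  \<comment> \<open>The parent is the second vertex on the path to \<open>r\<close>. At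
    \<open>r\<close> the path has no second vertex, so the value is set separately.\<close>
  define f where "f = (\<lambda>v\<in>?V. if v = r then r else P v ! 1)"
  have f_eq: "f v = hd p" if "v \<in> ?V" "P v = v # p" "p \<noteq> []" "v \<noteq> r" for v p
    using that unfolding f_def by (simp add: hd_conv_nth)
  have step: "P v = v # P (f v)" "{v, f v} \<in> E" if v: "v \<in> ?V" "v \<noteq> r" for v
  proof -
    obtain w p where p: "P v = v # w # p"
      using P[OF v(1)] v(2) by (cases "P v" rule: remdups_adj.cases) auto
    then have "f v = w" using f_eq[OF v(1)] v(2) by simp
    moreover have "{v, w} \<in> E" "is_path E (w # p) w r" using P[OF v(1)] p by auto
    ultimately show "P v = v # P (f v)" "{v, f v} \<in> E" using p P_eq edge by auto
  qed
  have reach: "reaches f {r} v" if "v \<in> ?V" for v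
    using that
  proof (induction "length (P v)" arbitrary: v rule: less_induct)
    case less
    show ?case
    proof (cases "v = r")
      case False
      then have "length (P (f v)) < length (P v)" "f v \<in> ?V"
        using step[OF less.prems] edge by auto
      then show ?thesis using less.hyps by (blast intro: reaches.step)
    qed (auto intro: reaches.base)
  qed
  have "f \<in> ?V \<rightarrow>\<^sub>E ?V"
  proof (rule PiE_I)
    fix v assume v: "v \<in> ?V"
    show "f v \<in> ?V"
    proof (cases "v = r")
      case True
      then show ?thesis using assms(2) by (simp add: f_def)
    next
      case False
      then show ?thesis using step(2)[OF v] edge(2) by blast
    qed
  qed (auto simp: f_def)
  moreover have "f r = r" using assms(2) by (simp add: f_def)
  ultimately have F: "f \<in> forests ?V {r}" using reach by (intro forestsI) auto
  have "E = forest_edges ?V f r"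
  proof
    show "forest_edges ?V f r \<subseteq> E" using step(2) unfolding forest_edges_def by blast
    \<comment> \<open>If \<open>a\<close> is not on the path from \<open>b\<close>, prepending it
      gives the path from \<open>a\<close>, whose second vertex is \<open>b\<close>.\<close>
    have parent: "f a = b" "a \<noteq> r" if e: "{a, b} \<in> E" and b: "a \<notin> set (P b)" for a b
    proof -
      note V = edge[OF e]
      have "is_path E (a # P b) a r"
        using P[OF V(2)] is_path_hd[OF P[OF V(2)]] e b by (auto simp: is_path_Cons_iff)
      then have "P a = a # P b" using P_eq V by blast
      moreover show "a \<noteq> r"
        using P[OF V(2)] b unfolding is_path_def by (metis last_in_set)
      moreover have "P b \<noteq> []" "hd (P b) = b" using P[OF V(2)] unfolding is_path_def by auto
      ultimately show "f a = b" using f_eq V(1) by metis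
    qed
    show "E \<subseteq> forest_edges ?V f r"
    proof
      fix e assume "e \<in> E"
      then obtain a b where e: "e = {a, b}" "{a, b} \<in> E"
        using assms(1) unfolding is_tree_def edge_sets_def by blast
      note V = edge[OF e(2)]
      \<comment> \<open>Otherwise \<open>P b\<close> would be the suffix of \<open>P a\<close>
        starting at \<open>b\<close> and would contain \<open>a\<close> a second time, after the
        head of \<open>P a\<close>.\<close>
      have "a \<notin> set (P b) \<or> b \<notin> set (P a)"
      proof (rule ccontr)
        assume "\<not> ?thesis"
        then have ab: "a \<in> set (P b)" and ba: "b \<in> set (P a)" by auto
        obtain xs ys where Pa: "P a = xs @ b # ys" using split_list[OF ba] by blast
        then have "P b = b # ys" using P[OF V(1)] is_path_suffix P_eq[OF V(2)] by metis
        then have "a \<in> set ys" using ab V(3) by auto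
        moreover have "distinct (P a)" "hd (P a) = a" using P[OF V(1)] unfolding is_path_def by auto
        ultimately show False using Pa V(3) by (cases xs) auto
      qed
      then show "e \<in> forest_edges ?V f r"
      proof
        assume "a \<notin> set (P b)"
        then have "f a = b" "a \<noteq> r" using parent e by auto
        then show ?thesis using V e unfolding forest_edges_def by blast
      next
        assume "b \<notin> set (P a)"
        then have "f b = a" "b \<noteq> r" using parent[of b a] e by (auto simp: insert_commute)
        then show ?thesis using V e unfolding forest_edges_def by (auto simp: insert_commute)
      qed
    qed
  qed
  with F show thesis by (rule that)
qed

definition rooted_forests ::
    "'a set \<Rightarrow> nat \<Rightarrow> nat \<Rightarrow> (('a \<Rightarrow> 'a) \<times> 'a \<times> 'a \<times> 'a) set" where
  "rooted_forests V i j = {(f, r, u, v). r \<in> V \<and> u \<in> V \<and> v \<in> V \<and> f \<in> forests V {r} \<and>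
      height f r u = i \<and> height f r v = j}"

text \<open>The first root stays a component of the image, since the edge set alone does not
  determine the direction of the parents.\<close>

lemma card_W: "card (W n i j) = card (rooted_forests {1..n} i j)"
proof -
  let ?F = "\<lambda>(f, r, u, v). (forest_edges {1..n} f r, r, u, v)"
  have inj: "inj_on ?F (rooted_forests {1..n} i j)"
    by (auto simp: inj_on_def rooted_forests_def intro: forest_edges_inj)
  have "?F ` rooted_forests {1..n} i j = W n i j"
  proof
    show "?F ` rooted_forests {1..n} i j \<subseteq> W n i j"
      using is_tree_forest_edges tree_dist_forest unfolding W_def rooted_forests_def by auto
    show "W n i j \<subseteq> ?F ` rooted_forests {1..n} i j"
    proof
      fix x assume "x \<in> W n i j"
      then obtain E r u v where x: "x = (E, r, u, v)" "is_tree n E"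
        "r \<in> {1..n}" "u \<in> {1..n}" "v \<in> {1..n}" "tree_dist E r u = i" "tree_dist E r v = j"
        unfolding W_def by auto
      obtain f where f: "f \<in> forests {1..n} {r}" "E = forest_edges {1..n} f r"
        using tree_is_forest_edges x by blast
      then have "(f, r, u, v) \<in> rooted_forests {1..n} i j"
        using x tree_dist_forest[OF f(1) x(3)] unfolding rooted_forests_def by auto
      then show "x \<in> ?F ` rooted_forests {1..n} i j"
        using x f by force
    qed
  qed
  then show ?thesis using card_image[OF inj] by simp
qed

subsection \<open>The subtree spanned by the roots\<close>

text \<open>The union of the two root paths is coded by a list \<open>xs\<close>: entries \<open>0..i\<close> are the path from the
  first to the second root, entries \<open>i+1..i+j-d\<close> the part of the path to the third root that starts
  below their common initial segment of length \<open>d\<close>. Entry \<open>t\<close> has its parent at index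
  \<open>spine_parent i d t\<close>, and the depth-\<open>k\<close> vertex of the second path is at index \<open>branch_index i d k\<close>.
  Truncated subtraction makes the first root its own parent.\<close>

definition spine_parent :: "nat \<Rightarrow> nat \<Rightarrow> nat \<Rightarrow> nat" where
  "spine_parent i d t = (if t = Suc i then d else t - 1)"

definition branch_index :: "nat \<Rightarrow> nat \<Rightarrow> nat \<Rightarrow> nat" where
  "branch_index i d k = (if k \<le> d then k else i + k - d)"

text \<open>Distinctness of the list makes the two root paths separate at depth exactly
  \<open>d\<close>, so the spine determines \<open>d\<close>.\<close>

definition spined_forests :: "'a set \<Rightarrow> nat \<Rightarrow> nat \<Rightarrow> nat \<Rightarrow> ('a list \<times> ('a \<Rightarrow> 'a)) set" where
  "spined_forests V i j d = (SIGMA xs:{xs. length xs = i + j - d + 1 \<and> distinct xs \<and> set xs \<subseteq> V}.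
     {f \<in> forests V {xs ! 0}. \<forall>t<length xs. f (xs ! t) = xs ! spine_parent i d t})"

text \<open>Parent indices that strictly decrease make the listed vertices a tree rooted at
  \<open>xs ! 0\<close>. Distinctness turns the index map \<open>pp\<close> into the vertex map
  \<open>p\<close>, and extending \<open>p\<close> is then a forest count.\<close>

lemma card_forests_spine:
  assumes "finite V" "distinct xs" "set xs \<subseteq> V" "xs \<noteq> []"
    and par: "pp 0 = 0" "\<And>t. 0 < t \<Longrightarrow> t < length xs \<Longrightarrow> pp t < t"
  shows "card {f \<in> forests V {xs ! 0}. \<forall>t<length xs. f (xs ! t) = xs ! pp t} = card (forests V (set xs))"
proof -
  define p where "p = (\<lambda>v\<in>set xs. xs ! pp (THE t. t < length xs \<and> xs ! t = v))"
  have p: "p (xs ! t) = xs ! pp t" if "t < length xs" for t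
  proof -
    have "(THE s. s < length xs \<and> xs ! s = xs ! t) = t"
      using that assms(2) by (auto simp: nth_eq_iff_index_eq)
    then show ?thesis using that by (simp add: p_def)
  qed
  have pp: "pp t < length xs" if "t < length xs" for t
    using par that by (cases "t = 0") (auto intro: less_trans)
  have reach: "reaches p {xs ! 0} (xs ! t)" if "t < length xs" for t
    using that
  proof (induction t rule: less_induct)
    case (less t)
    show ?case
    proof (cases "t = 0")
      case True
      then show ?thesis by (auto intro: reaches.base)
    next
      case False
      then have "reaches p {xs ! 0} (xs ! pp t)"
        using less.IH par pp less.prems by blast
      then show ?thesis using p[OF less.prems] by (rule reaches_step_eq[rotated])
    qed
  qed
  have "p \<in> forests (set xs) {xs ! 0}"
  proof (rule forestsI)
    show "p \<in> set xs \<rightarrow>\<^sub>E set xs"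
    proof (rule PiE_I)
      show "p v \<in> set xs" if "v \<in> set xs" for v
        using that p pp by (metis in_set_conv_nth nth_mem)
    qed (simp add: p_def)
    show "p s = s" if "s \<in> {xs ! 0}" for s
      using that p[of 0] par(1) assms(4) by simp
    show "reaches p {xs ! 0} v" if "v \<in> set xs" for v
      using that reach by (metis in_set_conv_nth)
  qed
  moreover have "(\<forall>s\<in>set xs. f s = p s) \<longleftrightarrow> (\<forall>t<length xs. f (xs ! t) = xs ! pp t)" for f
    using p by (auto simp: all_set_conv_all_nth)
  ultimately show ?thesis
    using card_forests_extending[of "set xs" V "xs ! 0" p] assms by simp
qed

lemma finite_distinct_lists:
  "finite V \<Longrightarrow> finite {xs. length xs = k \<and> distinct xs \<and> set xs \<subseteq> V}"
  by (rule finite_subset[OF _ finite_lists_length_eq[of V k]]) auto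

lemma finite_spined_forests: "finite V \<Longrightarrow> finite (spined_forests V i j d)"
  unfolding spined_forests_def
  by (intro finite_SigmaI finite_distinct_lists finite_subset[OF _ finite_forests[of V]]) auto

text \<open>The product is the falling factorial n!/(n-k)! counting the labelled spines. All spines
  carry the same number of forests, as that number depends only on \<open>k\<close>.\<close>

lemma card_spined_forests:
  assumes "finite V" "d \<le> i" "d \<le> j" and k: "k = i + j - d + 1"
  shows "card V * card (spined_forests V i j d) =
    (if k \<le> card V then \<Prod>{card V - k + 1..card V} * (k * card V ^ (card V - k)) else 0)"
proof -
  let ?L = "{xs. length xs = k \<and> distinct xs \<and> set xs \<subseteq> V}"
  have "card V * card (spined_forests V i j d) =
    (\<Sum>xs\<in>?L. card V * card {f \<in> forests V {xs ! 0}. \<forall>t<length xs. f (xs ! t) = xs ! spine_parent i d t})"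
    unfolding spined_forests_def k[symmetric]
    using finite_distinct_lists[OF assms(1)] finite_forests[OF assms(1)]
    by (subst card_SigmaI) (auto simp: sum_distrib_left)
  also have "\<dots> = (\<Sum>xs\<in>?L. k * card V ^ (card V - k))"
  proof (rule sum.cong[OF refl])
    fix xs assume xs: "xs \<in> ?L"
    then have "card {f \<in> forests V {xs ! 0}. \<forall>t<length xs. f (xs ! t) = xs ! spine_parent i d t} =
      card (forests V (set xs))"
      using assms by (intro card_forests_spine) (auto simp: spine_parent_def)
    moreover have "card (set xs) = k" using xs by (auto simp: distinct_card)
    ultimately show "card V * card {f \<in> forests V {xs ! 0}. \<forall>t<length xs. f (xs ! t) = xs ! spine_parent i d t} =
      k * card V ^ (card V - k)"
      using card_forests[OF assms(1), of "set xs"] xs by simp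
  qed
  also have "\<dots> = card ?L * (k * card V ^ (card V - k))" by simp
  finally have *: "card V * card (spined_forests V i j d) = card ?L * (k * card V ^ (card V - k))" .
  show ?thesis
  proof (cases "k \<le> card V")
    case True
    then show ?thesis using * card_lists_distinct_length_eq[OF assms(1) True] by simp
  next
    case False
    have "?L = {}"
    proof (rule ccontr)
      assume "?L \<noteq> {}"
      then obtain xs where "length xs = k" "distinct xs" "set xs \<subseteq> V" by blast
      then show False using False card_mono[OF assms(1)] distinct_card by metis
    qed
    then have "card ?L = 0" by (simp only: card.empty)
    then show ?thesis unfolding * using False by simp
  qed
qed

section \<open>Recovering the spine from a parent function and three roots\<close>

lemma funpow_descending:
  assumes "\<And>k. k < m \<Longrightarrow> f (y (Suc k)) = y k" "l \<le> m"
  shows "(f ^^ l) (y m) = y (m - l)"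
  using assms(2)
proof (induction l)
  case (Suc l)
  then have "f (y (Suc (m - Suc l))) = y (m - Suc l)" by (intro assms(1)) auto
  then show ?case using Suc by (simp add: Suc_diff_Suc)
qed simp

lemma height_ascending:
  assumes f: "f \<in> forests V {r}" and "y 0 = r"
    and y: "\<And>k. k < m \<Longrightarrow> f (y (Suc k)) = y k \<and> y (Suc k) \<in> V \<and> y (Suc k) \<noteq> r"
  shows "k \<le> m \<Longrightarrow> height f r (y k) = k"
proof (induction k)
  case (Suc k)
  then show ?case using height_step[OF f, of "y (Suc k)"] y[of k] by auto
qed (simp add: assms(2))

text \<open>The first two parts express every entry of \<open>xs\<close> by iterating
  \<open>f\<close> from the second or third root; injectivity of the coding rests on this.\<close>

lemma spined_forests_paths:
  assumes x: "(xs, f) \<in> spined_forests V i j d" and d: "d \<le> i" "d \<le> j"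
  shows "k \<le> i \<Longrightarrow> (f ^^ (i - k)) (xs ! i) = xs ! k"
    and "k \<le> j \<Longrightarrow> (f ^^ (j - k)) (xs ! branch_index i d j) = xs ! branch_index i d k"
    and "height f (xs ! 0) (xs ! i) = i"
    and "height f (xs ! 0) (xs ! branch_index i d j) = j"
proof -
  have xs: "length xs = i + j - d + 1" "distinct xs" "set xs \<subseteq> V"
    and f: "f \<in> forests V {xs ! 0}"
    and par: "\<And>t. t < length xs \<Longrightarrow> f (xs ! t) = xs ! spine_parent i d t"
    using x unfolding spined_forests_def by auto
  have a: "f (xs ! Suc k) = xs ! k \<and> xs ! Suc k \<in> V \<and> xs ! Suc k \<noteq> xs ! 0" if "k < i" for k
    using par[of "Suc k"] xs that d nth_mem[of "Suc k" xs]
    by (auto simp: spine_parent_def nth_eq_iff_index_eq)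
  have b: "f (xs ! branch_index i d (Suc k)) = xs ! branch_index i d k \<and>
      xs ! branch_index i d (Suc k) \<in> V \<and> xs ! branch_index i d (Suc k) \<noteq> xs ! 0" if "k < j" for k
  proof -
    have 1: "branch_index i d (Suc k) < length xs" "branch_index i d (Suc k) \<noteq> 0"
      using that d xs by (auto simp: branch_index_def)
    \<comment> \<open>The critical case is \<open>k = d\<close>: the index is then
      \<open>Suc i\<close>, whose parent index jumps back to \<open>d\<close>.\<close>
    moreover have "spine_parent i d (branch_index i d (Suc k)) = branch_index i d k"
      using that d by (auto simp: branch_index_def spine_parent_def)
    moreover have "xs ! branch_index i d (Suc k) \<in> V" using 1 xs nth_mem by blast
    moreover have "xs ! branch_index i d (Suc k) \<noteq> xs ! 0"
      using 1 xs by (simp add: nth_eq_iff_index_eq)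
    ultimately show ?thesis using par by simp
  qed
  have b0: "xs ! branch_index i d 0 = xs ! 0" by (simp add: branch_index_def)
  show "(f ^^ (i - k)) (xs ! i) = xs ! k" if "k \<le> i"
    using funpow_descending[of i f "(!) xs" "i - k"] a that by simp
  show "(f ^^ (j - k)) (xs ! branch_index i d j) = xs ! branch_index i d k" if "k \<le> j"
    using funpow_descending[of j f "\<lambda>k. xs ! branch_index i d k" "j - k"] b that by simp
  show "height f (xs ! 0) (xs ! i) = i"
    using height_ascending[OF f, of "(!) xs" i i] a by simp
  show "height f (xs ! 0) (xs ! branch_index i d j) = j"
    using height_ascending[OF f, of "\<lambda>k. xs ! branch_index i d k" j j] b b0 by simp
qed

lemma branch_index_surj:
  assumes "i < t" "t < i + j - d + 1" "d \<le> j"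
  shows "\<exists>k>d. k \<le> j \<and> t = branch_index i d k"
  using assms by (intro exI[of _ "t + d - i"]) (auto simp: branch_index_def)

lemma bij_betw_spined_forests:
  "bij_betw (\<lambda>(d, xs, f). (f, xs ! 0, xs ! i, xs ! branch_index i d j))
     (SIGMA d:{0..min i j}. spined_forests V i j d) (rooted_forests V i j)"
  (is "bij_betw ?F ?A ?B")
proof (rule bij_betw_imageI)
  \<comment> \<open>The left-hand set mentions only \<open>f\<close> and the second and third roots,
    so it recovers \<open>d\<close>.\<close>
  have common: "{k. k \<le> i \<and> k \<le> j \<and>
      (f ^^ (i - k)) (xs ! i) = (f ^^ (j - k)) (xs ! branch_index i d j)} = {..d}"
    if "(xs, f) \<in> spined_forests V i j d" "d \<le> i" "d \<le> j" for d xs f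
  proof -
    have "distinct xs" "length xs = i + j - d + 1"
      using that(1) unfolding spined_forests_def by auto
    then have "xs ! k = xs ! branch_index i d k \<longleftrightarrow> k \<le> d" if "k \<le> i" "k \<le> j" for k
      using that \<open>d \<le> i\<close> \<open>d \<le> j\<close> by (auto simp: nth_eq_iff_index_eq branch_index_def)
    then show ?thesis using spined_forests_paths(1,2)[OF that] that by auto
  qed
  show "inj_on ?F ?A"
  proof (rule inj_onI)
    fix x x' assume "x \<in> ?A" "x' \<in> ?A" and eq: "?F x = ?F x'"
    then obtain d xs f d' xs' where x: "x = (d, xs, f)" "x' = (d', xs', f)"
      and s: "(xs, f) \<in> spined_forests V i j d" "(xs', f) \<in> spined_forests V i j d'"
      and d: "d \<le> i" "d \<le> j" "d' \<le> i" "d' \<le> j"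
      by auto
    have r: "xs ! i = xs' ! i" "xs ! branch_index i d j = xs' ! branch_index i d' j"
      using eq unfolding x by auto
    have "{..d} = {..d'}"
      unfolding common[OF s(1) d(1,2), symmetric] common[OF s(2) d(3,4), symmetric] r ..
    then have dd: "d' = d" by simp
    have "xs ! t = xs' ! t" if "t < i + j - d + 1" for t
    proof (cases "t \<le> i")
      case True
      then show ?thesis
        using spined_forests_paths(1)[OF s(1) d(1,2)] spined_forests_paths(1)[OF s(2) d(3,4)] r
        by metis
    next
      case False
      then have "i < t" by simp
      then obtain k where "k \<le> j" "t = branch_index i d k"
        using branch_index_surj[OF _ \<open>t < i + j - d + 1\<close> d(2)] by blast
      then show ?thesis
        using spined_forests_paths(2)[OF s(1) d(1,2)] spined_forests_paths(2)[OF s(2) d(3,4)] r dd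
        by metis
    qed
    moreover have "length xs = i + j - d + 1" "length xs' = i + j - d + 1"
      using s dd unfolding spined_forests_def by auto
    ultimately show "x = x'" unfolding x dd by (auto intro: nth_equalityI)
  qed
  show "?F ` ?A = ?B"
  proof
    show "?F ` ?A \<subseteq> ?B"
    proof
      fix y assume "y \<in> ?F ` ?A"
      then obtain d xs f where y: "y = (f, xs ! 0, xs ! i, xs ! branch_index i d j)"
        and s: "(xs, f) \<in> spined_forests V i j d" and d: "d \<le> i" "d \<le> j"
        by auto
      have xs: "length xs = i + j - d + 1" "set xs \<subseteq> V" "f \<in> forests V {xs ! 0}"
        using s unfolding spined_forests_def by auto
      moreover have "branch_index i d j < length xs"
        using d xs by (auto simp: branch_index_def)
      ultimately show "y \<in> ?B"
        using spined_forests_paths(3,4)[OF s d] d nth_mem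
        unfolding y rooted_forests_def by auto
    qed
    show "?B \<subseteq> ?F ` ?A"
    proof
      fix y assume "y \<in> ?B"
      then obtain f r u v where y: "y = (f, r, u, v)" "r \<in> V" "u \<in> V" "v \<in> V"
        and f: "f \<in> forests V {r}" and h: "height f r u = i" "height f r v = j"
        unfolding rooted_forests_def by auto
      define a where "a k = (f ^^ (i - k)) u" for k
      define b where "b k = (f ^^ (j - k)) v" for k
      have aV: "a k \<in> V" and bV: "b k \<in> V" for k
        using funpow_in[OF f] y unfolding a_def b_def by auto
      have ha: "k \<le> i \<Longrightarrow> height f r (a k) = k" and hb: "k \<le> j \<Longrightarrow> height f r (b k) = k" for k
        using height_funpow[OF f] y h unfolding a_def b_def by auto
      have a0: "a 0 = r" and b0: "b 0 = r"
        using funpow_height[OF f] y h unfolding a_def b_def by auto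
      have fa: "f (a (Suc k)) = a k" if "k < i" for k
        using that Suc_diff_Suc[of k i] unfolding a_def by (metis comp_apply funpow.simps(2))
      have fb: "f (b (Suc k)) = b k" if "k < j" for k
        using that Suc_diff_Suc[of k j] unfolding b_def by (metis comp_apply funpow.simps(2))
      have fr: "f r = r" using forestsD(2)[OF f] by simp
      \<comment> \<open>The witness for \<open>d\<close> is the depth of the last common vertex;
        depth 0 is always common, so the maximum exists.\<close>
      let ?C = "{k. k \<le> min i j \<and> a k = b k}"
      define d where "d = Max ?C"
      have C: "finite ?C" "0 \<in> ?C" using a0 b0 by auto
      have dC: "d \<in> ?C" unfolding d_def using C by (intro Max_in) auto
      then have d: "d \<le> i" "d \<le> j" by auto
      \<comment> \<open>Agreement at depth \<open>d\<close> passes upward to all smaller depths by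
        applying \<open>f\<close>.\<close>
      have below: "a (d - m) = b (d - m)" for m
      proof (induction m)
        case (Suc m)
        show ?case
        proof (cases "m < d")
          case True
          then have "d - m = Suc (d - Suc m)" by simp
          then show ?thesis using Suc fa[of "d - Suc m"] fb[of "d - Suc m"] True d by simp
        qed (use Suc in simp)
      qed (use dC in simp)
      have ab: "a k = b k" if "k \<le> d" for k using below[of "d - k"] that by simp
      \<comment> \<open>Equal vertices have equal height, so a coincidence would occur at one common
        depth beyond the maximum \<open>d\<close>.\<close>
      have ab': "a k \<noteq> b l" if "k \<le> i" "d < l" "l \<le> j" for k l
      proof
        assume eq: "a k = b l"
        then have "k = l" using ha[OF that(1)] hb[OF that(3)] by simp
        then have "l \<in> ?C" using eq that by auto
        then have "l \<le> d" unfolding d_def using C by (intro Max_ge)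
        then show False using that by simp
      qed
      define xs where "xs = map a [0..<Suc i] @ map b [Suc d..<Suc j]"
      have len: "length xs = i + j - d + 1" using d unfolding xs_def by (simp, arith)
      have xa: "xs ! t = a t" if "t \<le> i" for t
        using that unfolding xs_def by (simp add: nth_append del: upt_Suc)
      have xb: "xs ! branch_index i d k = b k" if "k \<le> j" for k
      proof (cases "k \<le> d")
        case True
        then show ?thesis using xa[of k] ab d by (simp add: branch_index_def)
      next
        case False
        then have "\<not> i + k - d < Suc i" "i + k - d - Suc i = k - Suc d" "k - Suc d < Suc j - Suc d"
          using that by auto
        then show ?thesis using that False unfolding xs_def branch_index_def
          by (simp add: nth_append del: upt_Suc)
      qed
      have "inj_on a {0..<Suc i}" "inj_on b {Suc d..<Suc j}"
        by (rule inj_on_inverseI[of _ "height f r"], use ha hb in simp)+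
      then have dist: "distinct xs"
        unfolding xs_def using ab' by (auto simp: distinct_map simp del: upt_Suc)
      have sub: "set xs \<subseteq> V" unfolding xs_def using aV bV by auto
      have x0: "xs ! 0 = r" using xa[of 0] a0 by simp
      have "f (xs ! t) = xs ! spine_parent i d t" if t: "t < length xs" for t
      proof (cases "t \<le> i")
        case True
        then show ?thesis
          using fa[of "t - 1"] fr a0 xa[of t] xa[of "t - 1"]
          by (cases "t = 0") (auto simp: spine_parent_def)
      next
        case False
        then have "i < t" by simp
        then obtain k where k: "d < k" "k \<le> j" "t = branch_index i d k"
          using branch_index_surj[OF _ t[unfolded len] d(2)] by blast
        have "spine_parent i d t = branch_index i d (k - 1)"
          using k d by (auto simp: spine_parent_def branch_index_def)
        moreover have "f (b k) = b (k - 1)" using fb[of "k - 1"] k by simp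
        ultimately show ?thesis using xb[of k] xb[of "k - 1"] k by simp
      qed
      then have "(xs, f) \<in> spined_forests V i j d"
        unfolding spined_forests_def using len dist sub f x0 by auto
      moreover have "y = ?F (d, xs, f)"
        using x0 xa[of i] xb[of j] y unfolding a_def b_def by simp
      ultimately show "y \<in> ?F ` ?A" using d by (intro image_eqI[of _ _ "(d, xs, f)"]) auto
    qed
  qed
qed

theorem theorem3:
  fixes n i j :: nat
  assumes "n \<ge> 1"
  shows "real (card (W n i j)) = (\<Sum>d = 0..min i j. W_term n i j d)"
proof -
  let ?V = "{1..n}"
  have "card (W n i j) = (\<Sum>d = 0..min i j. card (spined_forests ?V i j d))"
    unfolding card_W bij_betw_same_card[OF bij_betw_spined_forests, symmetric]
    by (subst card_SigmaI) (auto intro: finite_spined_forests)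
  moreover have "real (card (spined_forests ?V i j d)) = W_term n i j d"
    if d: "d \<in> {0..min i j}" for d
  proof -
    define k where "k = i + j - d + 1"
    have "d \<le> i" "d \<le> j" using d by auto
    note c = card_spined_forests[OF _ this k_def, of ?V, simplified]
    have m: "int n - int i - int j + int d - 1 = int n - int k" using d by (simp add: k_def)
    show ?thesis
    proof (cases "k \<le> n")
      case True
      define P where "P = \<Prod>{n - k + 1..n}"
      have "fact n = fact (n - k) * P"
        using fact_eq_fact_times[of "n - k" n] by (simp add: P_def)
      then have "real (fact n) = real (fact (n - k) * P)" by (rule arg_cong)
      then have P: "real P = fact n / fact (n - k)" by (simp add: field_simps)
      have "n * card (spined_forests ?V i j d) = P * (k * n ^ (n - k))"
        using c True by (simp add: P_def)
      then have "real n * real (card (spined_forests ?V i j d)) = real P * (real k * real n ^ (n - k))"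
        by (simp flip: of_nat_mult of_nat_power)
      then have "real (card (spined_forests ?V i j d)) =
        fact n / fact (n - k) * (real k * real n ^ (n - k)) / real n"
        unfolding P using assms by (simp add: field_simps)
      \<comment> \<open>The exponent is -1 when the spine uses all vertices, hence the integer power
        and the division by \<open>n\<close>.\<close>
      moreover have "real n powi (int n - int k - 1) = real n ^ (n - k) / real n"
        using assms True by (simp add: power_int_diff flip: of_nat_diff)
      moreover have "nat (int n - int k) = n - k" by simp
      moreover have "real (i + j - d + 1) = real k" by (simp add: k_def)
      ultimately show ?thesis
        unfolding W_term_def m Let_def using True by (simp add: mult_ac)
    next
      case False
      then show ?thesis
        unfolding W_term_def m Let_def using c assms by simp
    qed
  qed
  ultimately show ?thesis by simp
qed

end
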